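(* Let $f_n\in\mathcal{V}$ ($n\in\mathbb{N}$) and $f\in\mathcal{V}$. Then $f_n$ converges basically to $f$ if and only if there exist constants $(c_n)_{n\in\mathbb{N}}$ in $\mathbb{R}$ such that for each subsequence $(f_{n_k})_{k\in\mathbb{N}}$ of $(f_n)_{n\in\mathbb{N}}$ there exist a further subsequence $(f_{n_{k_l}})_{l\in\mathbb{N}}$ and an at most countable set $S$ such that $f_{n_{k_l}}(x)-c_{n_{k_l}}\to f(x)$ as $l\to\infty$ for all $x\in\mathbb{R}\setminus S$.
   Context: $\mathcal{V}$ is the set of right-continuous functions $f:\mathbb{R}\to\mathbb{R}$ of bounded variation (i.e. $\lim_{n\to\infty}TV_{[-n,n]}f<\infty$, where $TV_{[a,b]}f$ is the total variation of $f$ on $[a,b]$). Functions $f_n:\mathbb{R}\to\mathbb{R}$ converge basically to $f:\mathbb{R}\to\mathbb{R}$ if every subsequence $(f_{n_k})_{k}$ contains a further subsequence $(f_{n_{k_l}})_{l}$ and there is an at most countable set $S\subset\mathbb{R}$ (which may depend on the subsequence) such that $f_{n_{k_l}}(x_1)-f_{n_{k_l}}(x_2)\to f(x_1)-f(x_2)$ as $l\to\infty$ for all $x_1,x_2\in\mathbb{R}\setminus S$. *)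

theory Defs
  imports "HOL-Analysis.Analysis"
begin

(* Supremum over all partitions a = t 0 <= t 1 <= ... <= t N = b; repeated points contribute
   zero summands, and N = 0 is possible only for a = b. Only meant for a <= b. *)
definition total_variation :: "real \<Rightarrow> real \<Rightarrow> (real \<Rightarrow> real) \<Rightarrow> ennreal" where
  "total_variation a b f =
     (SUP (N, t) \<in> {(N :: nat, t :: nat \<Rightarrow> real). t 0 = a \<and> t N = b \<and> (\<forall>i<N. t i \<le> t (Suc i))}.
        \<Sum>i<N. ennreal \<bar>f (t (Suc i)) - f (t i)\<bar>)"

definition bounded_variation :: "(real \<Rightarrow> real) \<Rightarrow> bool" where
  "bounded_variation f \<longleftrightarrow>
     (\<exists>L<\<infinity>. (\<lambda>n::nat. total_variation (- real n) (real n) f) \<longlonglongrightarrow> L)"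

definition right_continuous_BV :: "(real \<Rightarrow> real) set" ("\<V>") where
  "\<V> = {f. (\<forall>x. continuous (at_right x) f) \<and> bounded_variation f}"

definition converges_basically :: "(nat \<Rightarrow> real \<Rightarrow> real) \<Rightarrow> (real \<Rightarrow> real) \<Rightarrow> bool" where
  "converges_basically F f \<longleftrightarrow>
     (\<forall>r :: nat \<Rightarrow> nat. strict_mono r \<longrightarrow>
        (\<exists>(s :: nat \<Rightarrow> nat) S. strict_mono s \<and> countable S \<and>
           (\<forall>x1 \<in> UNIV - S. \<forall>x2 \<in> UNIV - S.
              (\<lambda>l. F (r (s l)) x1 - F (r (s l)) x2) \<longlonglongrightarrow> f x1 - f x2)))"

end

theory Submission
  imports Defs
begin

text \<open>
  The difficulty is that the constants must be chosen before the subsequence and its exceptional set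
  are known. Put \<open>g\<^sub>n = f\<^sub>n - f\<close> and let \<open>c\<^sub>n\<close> minimise \<open>\<phi>\<^sub>n(c) = \<integral>\<^sub>0\<^sup>1 min 1 \<bar>g\<^sub>n(x) - c\<bar> dx\<close> up to
  an error \<open>1/(n+1)\<close>. If along a subsequence \<open>g\<^sub>n(x) - g\<^sub>n(x\<^sub>0) \<rightarrow> 0\<close> for almost every \<open>x\<close>, then
  \<open>\<phi>\<^sub>n(g\<^sub>n(x\<^sub>0)) \<rightarrow> 0\<close> by dominated convergence, hence \<open>\<phi>\<^sub>n(c\<^sub>n) \<rightarrow> 0\<close>, and the triangle inequality for
  \<open>min 1 \<bar>u - v\<bar>\<close> gives \<open>c\<^sub>n - g\<^sub>n(x\<^sub>0) \<rightarrow> 0\<close>. The truncation is essential, since the \<open>g\<^sub>n\<close> need not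
  have uniformly bounded variation.
\<close>

text \<open>\<open>f\<close> is the pointwise limit of its composites with step functions that
  approach the identity from the right, and each composite is Borel.\<close>

lemma borel_measurable_right_continuous:
  fixes f :: "real \<Rightarrow> real"
  assumes "\<And>x. continuous (at_right x) f"
  shows "f \<in> borel_measurable borel"
proof (rule borel_measurable_LIMSEQ_real)
  \<comment> \<open>\<open>?p n x\<close> is the least multiple of \<open>1 / Suc n\<close> strictly
    above \<open>x\<close>. Floor plus one, unlike the ceiling, exceeds \<open>x\<close> even at
    grid points, as \<open>at_right x\<close> demands.\<close>
  let ?p = "\<lambda>(n::nat) (x::real). (of_int \<lfloor>real (Suc n) * x\<rfloor> + 1) / real (Suc n)"
  show "(\<lambda>n. f (?p n x)) \<longlonglongrightarrow> f x" for x
  proof -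
    have gt: "x < ?p n x" for n
    proof -
      have "real (Suc n) * x < of_int \<lfloor>real (Suc n) * x\<rfloor> + 1" by linarith
      then show ?thesis by (simp add: pos_less_divide_eq mult.commute del: of_nat_Suc)
    qed
    have le: "?p n x \<le> x + 1 / real (Suc n)" for n
    proof -
      have "of_int \<lfloor>real (Suc n) * x\<rfloor> \<le> real (Suc n) * x" by linarith
      then show ?thesis by (simp add: field_simps del: of_nat_Suc)
    qed
    have "(\<lambda>n. x + 1 / real (Suc n)) \<longlonglongrightarrow> x + 0"
      by (intro tendsto_intros LIMSEQ_Suc[OF lim_1_over_n])
    then have "(\<lambda>n. x + 1 / real (Suc n)) \<longlonglongrightarrow> x" by simp
    then have "(\<lambda>n. ?p n x) \<longlonglongrightarrow> x"
      by (rule tendsto_sandwich[OF always_eventually always_eventually tendsto_const, rotated 2])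
        (use less_imp_le[OF gt] le in blast)+
    then have "filterlim (\<lambda>n. ?p n x) (at_right x) sequentially"
      unfolding filterlim_at using gt less_imp_neq[OF gt, symmetric] by (simp del: of_nat_Suc)
    moreover have "(f \<longlongrightarrow> f x) (at_right x)"
      using assms by (simp add: continuous_within)
    ultimately show ?thesis
      by (rule filterlim_compose[rotated])
  qed
  show "(\<lambda>x. f (?p n x)) \<in> borel_measurable borel" for n
  proof -
    \<comment> \<open>The composite factors through the integers, on which, being discrete, every
      map is measurable.\<close>
    have "(\<lambda>x. \<lfloor>real (Suc n) * x\<rfloor>) \<in> borel \<rightarrow>\<^sub>M count_space UNIV"
      by measurable
    moreover have "(\<lambda>k. f ((of_int k + 1) / real (Suc n))) \<in> count_space UNIV \<rightarrow>\<^sub>M borel"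
      by simp
    ultimately show ?thesis
      by (rule measurable_compose)
  qed
qed

text \<open>\<open>c\<close> is fixed before \<open>r\<close> and \<open>a\<close>, so one sequence
  serves all subsequences. On a finite measure space the integral of
  \<open>min 1 \<bar>u - v\<bar>\<close> metrises convergence in measure; between constants this is
  ordinary convergence.\<close>

lemma (in finite_measure) ex_centering_sequence:
  fixes g :: "nat \<Rightarrow> 'a \<Rightarrow> real"
  assumes meas: "\<And>n. g n \<in> borel_measurable M" and pos: "measure M (space M) > 0"
  obtains c :: "nat \<Rightarrow> real" where
    "\<And>r a. \<lbrakk>strict_mono r; AE x in M. (\<lambda>k. g (r k) x - a k) \<longlonglongrightarrow> 0\<rbrakk>
       \<Longrightarrow> (\<lambda>k. c (r k) - a k) \<longlonglongrightarrow> 0"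
proof -
  define \<phi> where "\<phi> n c = (\<integral>x. min 1 \<bar>g n x - c\<bar> \<partial>M)" for n c
  note [measurable] = meas
  have int: "integrable M (\<lambda>x. min 1 \<bar>g n x - c\<bar>)" for n c
    by (rule integrable_const_bound[where B = 1]) auto
  have nonneg: "0 \<le> \<phi> n c" for n c
    unfolding \<phi>_def by (rule Bochner_Integration.integral_nonneg) auto
  \<comment> \<open>The slack \<open>1 / Suc n\<close> avoids asking whether the infimum is
    attained, and it vanishes along every subsequence.\<close>
  have "\<exists>c. \<forall>a. \<phi> n c \<le> \<phi> n a + 1 / real (Suc n)" for n
  proof -
    have bdd: "bdd_below (range (\<phi> n))"
      by (rule bdd_belowI[where m = 0]) (use nonneg in auto)
    have "Inf (range (\<phi> n)) < Inf (range (\<phi> n)) + 1 / real (Suc n)" by simp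
    then obtain c where "\<phi> n c < Inf (range (\<phi> n)) + 1 / real (Suc n)"
      using cInf_lessD[of "range (\<phi> n)"] by blast
    moreover have "Inf (range (\<phi> n)) \<le> \<phi> n a" for a
      using bdd by (intro cInf_lower) auto
    ultimately show ?thesis
      by (meson add_right_mono less_imp_le order_trans)
  qed
  then obtain c where c: "\<And>n a. \<phi> n (c n) \<le> \<phi> n a + 1 / real (Suc n)"
    by metis
  show thesis
  proof
    fix r :: "nat \<Rightarrow> nat" and a
    assume r: "strict_mono r" and ae: "AE x in M. (\<lambda>k. g (r k) x - a k) \<longlonglongrightarrow> 0"
    have "(\<lambda>k. \<phi> (r k) (a k)) \<longlonglongrightarrow> (\<integral>x. 0 \<partial>M)"
      unfolding \<phi>_def
    proof (rule integral_dominated_convergence[where w = "\<lambda>_. 1"])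
      show "AE x in M. (\<lambda>k. min 1 \<bar>g (r k) x - a k\<bar>) \<longlonglongrightarrow> 0"
        using ae
      proof eventually_elim
        case (elim x)
        have "(\<lambda>k. min 1 \<bar>g (r k) x - a k\<bar>) \<longlonglongrightarrow> min 1 \<bar>0\<bar>"
          by (intro tendsto_min tendsto_const tendsto_rabs elim)
        then show ?case by simp
      qed
    qed auto
    then have lim_a: "(\<lambda>k. \<phi> (r k) (a k)) \<longlonglongrightarrow> 0" by simp
    \<comment> \<open>Integrate the truncated triangle inequality through \<open>g (r k) x\<close>;
      near-minimality then bounds \<open>\<phi> (r k) (c (r k))\<close> by
      \<open>\<phi> (r k) (a k)\<close> plus the slack.\<close>
    have dist_le: "measure M (space M) * min 1 \<bar>c (r k) - a k\<bar>
        \<le> 2 * \<phi> (r k) (a k) + 1 / real (Suc (r k))" for k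
    proof -
      have "measure M (space M) * min 1 \<bar>c (r k) - a k\<bar> = (\<integral>x. min 1 \<bar>c (r k) - a k\<bar> \<partial>M)"
        by simp
      also have "\<dots> \<le> (\<integral>x. min 1 \<bar>g (r k) x - c (r k)\<bar> + min 1 \<bar>g (r k) x - a k\<bar> \<partial>M)"
        by (rule integral_mono) (use int in auto)
      also have "\<dots> = \<phi> (r k) (c (r k)) + \<phi> (r k) (a k)"
        unfolding \<phi>_def by (rule Bochner_Integration.integral_add) (rule int)+
      finally show ?thesis
        using c[of "r k" "a k"] by linarith
    qed
    have "(\<lambda>k. 1 / real (Suc (r k))) \<longlonglongrightarrow> 0"
      using LIMSEQ_subseq_LIMSEQ[OF LIMSEQ_Suc[OF lim_1_over_n] r] by (simp add: o_def)
    then have "(\<lambda>k. 2 * \<phi> (r k) (a k) + 1 / real (Suc (r k))) \<longlonglongrightarrow> 2 * 0 + 0"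
      by (intro tendsto_intros lim_a)
    then have "(\<lambda>k. 2 * \<phi> (r k) (a k) + 1 / real (Suc (r k))) \<longlonglongrightarrow> 0" by simp
    then have "(\<lambda>k. measure M (space M) * min 1 \<bar>c (r k) - a k\<bar>) \<longlonglongrightarrow> 0"
      by (rule tendsto_sandwich[OF always_eventually always_eventually tendsto_const, rotated 2])
        (use dist_le in auto)
    from tendsto_mult_left[OF this, of "inverse (measure M (space M))"]
    have lim: "(\<lambda>k. min 1 \<bar>c (r k) - a k\<bar>) \<longlonglongrightarrow> 0"
      using pos by (simp add: mult.assoc[symmetric])
    \<comment> \<open>Once the truncated distance is below 1, the truncation is inactive.\<close>
    then have "\<forall>\<^sub>F k in sequentially. min 1 \<bar>c (r k) - a k\<bar> < 1"
      by (rule order_tendstoD) simp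
    then have "\<forall>\<^sub>F k in sequentially. min 1 \<bar>c (r k) - a k\<bar> = \<bar>c (r k) - a k\<bar>"
      by eventually_elim auto
    then have "(\<lambda>k. \<bar>c (r k) - a k\<bar>) \<longlonglongrightarrow> 0"
      using lim by (simp cong: tendsto_cong)
    then show "(\<lambda>k. c (r k) - a k) \<longlonglongrightarrow> 0"
      by (simp add: tendsto_rabs_zero_iff)
  qed
qed

theorem corollary3p10:
  fixes F :: "nat \<Rightarrow> real \<Rightarrow> real" and f :: "real \<Rightarrow> real"
  assumes "\<And>n. F n \<in> \<V>" and "f \<in> \<V>"
  shows "converges_basically F f \<longleftrightarrow>
    (\<exists>c :: nat \<Rightarrow> real. \<forall>r :: nat \<Rightarrow> nat. strict_mono r \<longrightarrow>
       (\<exists>(s :: nat \<Rightarrow> nat) S. strict_mono s \<and> countable S \<and>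
          (\<forall>x \<in> UNIV - S. (\<lambda>l. F (r (s l)) x - c (r (s l))) \<longlonglongrightarrow> f x)))"
    (is "_ \<longleftrightarrow> ?centered")
proof
  assume basic: "converges_basically F f"
  \<comment> \<open>A finite measure of positive mass for which countable sets are null.\<close>
  define M where "M = restrict_space lborel {0..1::real}"
  have [simp]: "space M = {0..1}"
    by (simp add: M_def space_restrict_space)
  have em: "emeasure M {0..1} = 1"
    by (simp add: M_def emeasure_restrict_space)
  interpret finite_measure M
    by (rule finite_measureI) (simp add: em)
  have meas: "h \<in> borel_measurable borel" if "h \<in> \<V>" for h
    using that borel_measurable_right_continuous by (auto simp: right_continuous_BV_def)
  have "(\<lambda>x. F n x - f x) \<in> borel_measurable M" for n
    unfolding M_def using meas[OF assms(1)] meas[OF assms(2)]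
    by (intro measurable_restrict_space1) simp
  moreover have "measure M (space M) > 0"
    by (simp add: measure_def em)
  ultimately obtain c where c: "\<And>r a. \<lbrakk>strict_mono r; AE x in M. (\<lambda>k. F (r k) x - f x - a k) \<longlonglongrightarrow> 0\<rbrakk>
       \<Longrightarrow> (\<lambda>k. c (r k) - a k) \<longlonglongrightarrow> 0"
    by (rule ex_centering_sequence[where g = "\<lambda>n x. F n x - f x"]) blast+
  have "\<exists>s S. strict_mono s \<and> countable S \<and>
          (\<forall>x \<in> UNIV - S. (\<lambda>l. F (r (s l)) x - c (r (s l))) \<longlonglongrightarrow> f x)"
    if r: "strict_mono r" for r :: "nat \<Rightarrow> nat"
  proof -
    obtain s S where s: "strict_mono s" and S: "countable S"
      and "\<forall>x1 \<in> UNIV - S. \<forall>x2 \<in> UNIV - S.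
        (\<lambda>l. F (r (s l)) x1 - F (r (s l)) x2) \<longlonglongrightarrow> f x1 - f x2"
      using basic[unfolded converges_basically_def, rule_format, OF r] by (elim exE conjE)
    then have lim: "(\<lambda>l. F (r (s l)) x1 - F (r (s l)) x2) \<longlonglongrightarrow> f x1 - f x2"
      if "x1 \<notin> S" "x2 \<notin> S" for x1 x2
      using that by simp
    obtain x0 where x0: "x0 \<notin> S"
      using S uncountable_UNIV_real by (cases "S = UNIV") auto
    \<comment> \<open>These centres depend on the subsequence and on \<open>x0\<close>;
      \<open>ca\<close> below replaces them by the universal \<open>c\<close>.\<close>
    define a where "a l = F (r (s l)) x0 - f x0" for l
    have pt: "(\<lambda>l. F (r (s l)) x - f x - a l) \<longlonglongrightarrow> 0" if "x \<notin> S" for x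
      using tendsto_diff[OF lim[OF that x0] tendsto_const[of "f x - f x0"]]
      by (simp add: a_def algebra_simps)
    have "AE x in lborel. x \<notin> S"
      using S by (intro AE_not_in countable_imp_null_set_lborel)
    then have "AE x in M. x \<notin> S"
      unfolding M_def by (subst AE_restrict_space_iff) auto
    then have "AE x in M. (\<lambda>l. F (r (s l)) x - f x - a l) \<longlonglongrightarrow> 0"
      by eventually_elim (rule pt)
    then have ca: "(\<lambda>l. c (r (s l)) - a l) \<longlonglongrightarrow> 0"
      using c[of "r \<circ> s" a] strict_mono_o[OF r s] by simp
    \<comment> \<open>Since \<open>ca\<close> concerns constants only, what was derived on the unit
      interval transfers to every \<open>x\<close> outside \<open>S\<close>.\<close>
    have "(\<lambda>l. F (r (s l)) x - c (r (s l))) \<longlonglongrightarrow> f x" if "x \<notin> S" for x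
      using tendsto_add[OF tendsto_diff[OF pt[OF that] ca] tendsto_const[of "f x"]]
      by (simp add: algebra_simps)
    then show ?thesis
      using s S by (intro exI[of _ s] exI[of _ S]) simp
  qed
  then show ?centered by blast
next
  assume ?centered
  then show "converges_basically F f"
    unfolding converges_basically_def
  proof (elim exE, intro allI impI)
    fix c :: "nat \<Rightarrow> real" and r :: "nat \<Rightarrow> nat"
    assume c: "\<forall>r :: nat \<Rightarrow> nat. strict_mono r \<longrightarrow> (\<exists>s S. strict_mono s \<and> countable S \<and>
        (\<forall>x \<in> UNIV - S. (\<lambda>l. F (r (s l)) x - c (r (s l))) \<longlonglongrightarrow> f x))"
      and r: "strict_mono r"
    obtain s S where s: "strict_mono s" "countable S"
      and lim: "\<forall>x \<in> UNIV - S. (\<lambda>l. F (r (s l)) x - c (r (s l))) \<longlonglongrightarrow> f x"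
      using c[rule_format, OF r] by (elim exE conjE)
    \<comment> \<open>The constants \<open>c (r (s l))\<close> cancel in the difference of the
      values at two points.\<close>
    have "(\<lambda>l. F (r (s l)) x1 - F (r (s l)) x2) \<longlonglongrightarrow> f x1 - f x2" if "x1 \<notin> S" "x2 \<notin> S" for x1 x2
      using tendsto_diff[OF lim[rule_format, of x1] lim[rule_format, of x2]] that by simp
    then show "\<exists>s S. strict_mono s \<and> countable S \<and>
        (\<forall>x1 \<in> UNIV - S. \<forall>x2 \<in> UNIV - S.
          (\<lambda>l. F (r (s l)) x1 - F (r (s l)) x2) \<longlonglongrightarrow> f x1 - f x2)"
      using s by (intro exI[of _ s] exI[of _ S]) simp
  qed
qed

end
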